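(* Let $(\mathbb{A},\star)$ be a finite-dimensional left-symmetric algebra over a field of characteristic zero that is right nilpotent and has nilpotent underlying Lie algebra. Then $\mathbb{T}(\mathbb{A})$ has dimension at least one. In this case there is some $m\ge1$ such that $\mathbb{T}^m(\mathbb{A})=\mathbb{A}$, and so $(\mathbb{A},\star)$ is nilpotent. If, moreover, $\mathbb{A}\star\mathbb{A}\neq\{0\}$, then $\mathbb{T}(\mathbb{A})\cap(\mathbb{A}\star\mathbb{A})\neq\{0\}$.
   Context: A left-symmetric algebra is a vector space $\mathbb{A}$ with a bilinear product $\star$ such that $[a,b]=a\star b-b\star a$ is a Lie bracket (the underlying Lie algebra) and $L([a,b])=[L(a),L(b)]$, where $L(a)b=a\star b$. Write $R(a)b=b\star a$. Define $\mathbb{R}^1(\mathbb{A})=\mathbb{A}$ and $\mathbb{R}^{i+1}(\mathbb{A})=\mathbb{R}^i(\mathbb{A})\star\mathbb{A}$. The algebra is right nilpotent if there is $k\ge1$ such that $\mathbb{R}^k(\mathbb{A})\neq\{0\}$ and $\mathbb{R}^{k+1}(\mathbb{A})=\{0\}$. It is nilpotent if there is $k$ such that every product of at least $k$ elements of $\mathbb{A}$, however associated, is zero. Let $\mathbb{T}(\mathbb{A})=\mathbb{T}^1(\mathbb{A})=\{a\in\mathbb{A}: a\star x=0=x\star a\text{ for all }x\in\mathbb{A}\}$ and, for $i\ge1$, $\mathbb{T}^{i+1}(\mathbb{A})=\{z\in\mathbb{A}: L(z)\mathbb{A}\subset\mathbb{T}^i(\mathbb{A}),\ R(z)\mathbb{A}\subset\mathbb{T}^i(\mathbb{A})\}$.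 $\mathbb{A}\star\mathbb{A}$ denotes the span of all products. *)

theory Defs
  imports Complex_Main
begin

locale nonassoc_algebra = vector_space scale
  for scale :: "'f::field \<Rightarrow> 'v::ab_group_add \<Rightarrow> 'v" +
  fixes mul :: "'v \<Rightarrow> 'v \<Rightarrow> 'v"  (infixl "\<star>" 70)
  assumes linear_left_mult: "Vector_Spaces.linear scale scale (\<lambda>b. a \<star> b)"
    and linear_right_mult: "Vector_Spaces.linear scale scale (\<lambda>a. a \<star> b)"
begin

definition span_prod :: "'v set \<Rightarrow> 'v set \<Rightarrow> 'v set" where
  "span_prod S U = span {x \<star> y | x y. x \<in> S \<and> y \<in> U}"

text \<open>The series is indexed from 1; the value at 0 is a dummy.\<close>

fun right_power :: "nat \<Rightarrow> 'v set" where
  "right_power 0 = UNIV"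
| "right_power (Suc 0) = UNIV"
| "right_power (Suc (Suc i)) = span_prod (right_power (Suc i)) UNIV"

text \<open>In particular the zero algebra is not right nilpotent.\<close>

definition right_nilpotent :: bool where
  "right_nilpotent \<longleftrightarrow> (\<exists>k\<ge>1. right_power k \<noteq> {0} \<and> right_power (k + 1) = {0})"

text \<open>\<open>is_product n x\<close>: \<open>x\<close> is a product of \<open>n\<close> elements of the algebra, with some bracketing.\<close>

inductive is_product :: "nat \<Rightarrow> 'v \<Rightarrow> bool" where
  single: "is_product 1 a"
| mult: "is_product m x \<Longrightarrow> is_product n y \<Longrightarrow> is_product (m + n) (x \<star> y)"

definition nilpotent :: bool where
  "nilpotent \<longleftrightarrow> (\<exists>k. \<forall>n\<ge>k. \<forall>x. is_product n x \<longrightarrow> x = 0)"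

text \<open>With the convention that the term of index 0 is \<open>{0}\<close>, the term of index 1 is the
  two-sided annihilator of the algebra.\<close>

primrec ann_series :: "nat \<Rightarrow> 'v set" where
  "ann_series 0 = {0}"
| "ann_series (Suc i) =
    {z. (\<forall>x. z \<star> x \<in> ann_series i) \<and> (\<forall>x. x \<star> z \<in> ann_series i)}"

end

locale lie_algebra = nonassoc_algebra scale bracket
  for scale :: "'f::field \<Rightarrow> 'v::ab_group_add \<Rightarrow> 'v"
    and bracket :: "'v \<Rightarrow> 'v \<Rightarrow> 'v" +
  assumes alternating: "bracket a a = 0"
    and jacobi: "bracket a (bracket b c) + bracket b (bracket c a) + bracket c (bracket a b) = 0"
begin

primrec lower_central_series :: "nat \<Rightarrow> 'v set" where
  "lower_central_series 0 = UNIV"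
| "lower_central_series (Suc i) = span_prod UNIV (lower_central_series i)"

definition lie_nilpotent :: bool where
  "lie_nilpotent \<longleftrightarrow> (\<exists>k. lower_central_series k = {0})"

end

definition commutator :: "('v \<Rightarrow> 'v \<Rightarrow> 'v) \<Rightarrow> 'v \<Rightarrow> 'v \<Rightarrow> 'v::ab_group_add" where
  "commutator mul a b = mul a b - mul b a"

locale left_symmetric_algebra = nonassoc_algebra scale mul
  for scale :: "'f::field \<Rightarrow> 'v::ab_group_add \<Rightarrow> 'v"
    and mul :: "'v \<Rightarrow> 'v \<Rightarrow> 'v"  (infixl "\<star>" 70) +
  assumes lie_algebra_commutator: "lie_algebra scale (commutator mul)"
    and left_symmetric: "commutator mul a b \<star> c = a \<star> (b \<star> c) - b \<star> (a \<star> c)"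

end

theory Submission
  imports Defs
begin

text \<open>
  Write \<open>R\<^sup>i\<close> for the right powers, \<open>C\<^sup>j\<close> for the lower central series of the commutator, and
  \<open>T\<^sup>n\<close> for the annihilator series. The proof rests on the identity
  \<open>a \<star> x = [a, x] + x \<star> a\<close>. Left symmetry makes every \<open>R\<^sup>i\<close> a two-sided ideal. Since
  \<open>R\<^sup>i \<star> A \<subseteq> R\<^sup>i\<^sup>+\<^sup>1\<close>, right multiplications vanish on \<open>R\<^sup>i / R\<^sup>i\<^sup>+\<^sup>1\<close>, so on that quotient
  the left multiplication by \<open>a\<close> coincides with \<open>ad a\<close>. As the Lie algebra is nilpotent,
  the ideals \<open>R\<^sup>i\<^sup>+\<^sup>1 + (R\<^sup>i \<inter> C\<^sup>j)\<close> refine the right powers to a finite descending chain from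
  \<open>A\<close> to \<open>0\<close> such that multiplication by \<open>A\<close>, on either side, moves each term into the next.

  The annihilator series is the fastest ascending chain with the same property, so it
  climbs past this chain (\<open>lower_central_inter_right_power_subset_ann_series\<close>) and reaches \<open>A\<close>
  (\<open>ann_series_eventually_UNIV\<close>). The rest is formal. In a product of at least \<open>2\<^sup>k\<close> factors some
  factor is nested at depth at least \<open>k\<close>, which gives nilpotency. A subset that is stable
  under multiplication by \<open>A\<close> and has a nonzero element meets \<open>T\<^sup>1\<close> nontrivially, because the
  first \<open>n\<close> for which it meets \<open>T\<^sup>n\<close> nontrivially must be \<open>1\<close>
  (\<open>ideal_meets_annihilator\<close>). This applies to \<open>A\<close> and to \<open>A \<star> A\<close>.
\<close>

context nonassoc_algebra
begin

lemma mul_simps [simp]: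
  "a \<star> 0 = 0" "0 \<star> a = 0"
  "a \<star> (b + c) = a \<star> b + a \<star> c" "(b + c) \<star> a = b \<star> a + c \<star> a"
  "a \<star> scale r b = scale r (a \<star> b)" "scale r b \<star> a = scale r (b \<star> a)"
proof -
  interpret left: Vector_Spaces.linear scale scale "\<lambda>b. a \<star> b" by (rule linear_left_mult)
  interpret right: Vector_Spaces.linear scale scale "\<lambda>b. b \<star> a" by (rule linear_right_mult)
  show "a \<star> 0 = 0" "0 \<star> a = 0"
    "a \<star> (b + c) = a \<star> b + a \<star> c" "(b + c) \<star> a = b \<star> a + c \<star> a"
    "a \<star> scale r b = scale r (a \<star> b)" "scale r b \<star> a = scale r (b \<star> a)"
    by (simp_all add: left.zero right.zero left.add right.add left.scale right.scale)
qed

lemma subspace_span_prod: "subspace (span_prod S U)"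
  unfolding span_prod_def by (rule subspace_span)

lemma mul_in_span_prod: "x \<in> S \<Longrightarrow> y \<in> U \<Longrightarrow> x \<star> y \<in> span_prod S U"
  unfolding span_prod_def by (blast intro: span_base)

lemma subspace_right_power: "subspace (right_power i)"
  by (induction i rule: right_power.induct) (simp_all add: subspace_span_prod)

lemma mul_in_right_power_Suc:
  assumes "x \<in> right_power (Suc i)"
  shows "x \<star> y \<in> right_power (Suc (Suc i))"
  using assms by (simp add: mul_in_span_prod)

lemma right_power_Suc_decreasing: "right_power (Suc (Suc i)) \<subseteq> right_power (Suc i)"
proof (induction i)
  case (Suc i)
  then show ?case
    unfolding right_power.simps(3) span_prod_def by (intro span_mono) auto
qed simp

lemma right_power_right_ideal: "x \<in> right_power (Suc i) \<Longrightarrow> x \<star> a \<in> right_power (Suc i)"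
  using mul_in_right_power_Suc right_power_Suc_decreasing by blast

lemma subspace_ann_series: "subspace (ann_series n)"
proof (induction n)
  case 0
  show ?case by (simp add: subspace_single_0)
next
  case (Suc n)
  then show ?case
    by (auto simp: subspace_def)
qed

lemma ann_series_Suc_mono: "ann_series n \<subseteq> ann_series (Suc n)"
proof (induction n)
  case 0
  show ?case by simp
next
  case (Suc n)
  then show ?case by auto
qed

lemma ann_series_mono: "m \<le> n \<Longrightarrow> ann_series m \<subseteq> ann_series n"
  by (rule lift_Suc_mono_le[of ann_series]) (rule ann_series_Suc_mono)

text \<open>At the first \<open>n\<close> for which the ideal meets \<open>T\<^sup>n\<close> in a nonzero element, products with that
  element lie in the ideal and in \<open>T\<^sup>n\<^sup>-\<^sup>1\<close>, hence vanish.\<close>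

lemma ideal_meets_annihilator:
  assumes full: "ann_series m = UNIV"
    and ideal: "\<And>z x. z \<in> I \<Longrightarrow> z \<star> x \<in> I" "\<And>z x. z \<in> I \<Longrightarrow> x \<star> z \<in> I"
    and nonzero: "w \<in> I" "w \<noteq> 0"
  shows "\<exists>z \<in> ann_series 1 \<inter> I. z \<noteq> 0"
proof -
  define P where "P n \<longleftrightarrow> (\<exists>z \<in> ann_series n \<inter> I. z \<noteq> 0)" for n
  have "P m" unfolding P_def using full nonzero by auto
  then obtain n where n: "P n" "\<And>k. k < n \<Longrightarrow> \<not> P k"
    using exists_least_iff[of P] by blast
  have "n \<noteq> 0" using n(1) by (cases n) (auto simp: P_def)
  then obtain k where k: "n = Suc k" by (cases n) auto
  have trivial: "y = 0" if "y \<in> ann_series k" "y \<in> I" for y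
    using n(2)[of k] that k by (auto simp: P_def)
  from n(1) k obtain z where z: "z \<in> ann_series (Suc k)" "z \<in> I" "z \<noteq> 0"
    by (auto simp: P_def)
  have "z \<in> ann_series 1"
    using z ideal trivial by simp
  with z show ?thesis by blast
qed

text \<open>One of the two factors of a product of at least \<open>2\<^sup>k\<^sup>+\<^sup>1\<close> elements has at least \<open>2\<^sup>k\<close>
  elements; if that factor lies in \<open>T\<^sup>d\<^sup>+\<^sup>1\<close>, then the product lies in \<open>T\<^sup>d\<close>.\<close>

lemma is_product_in_ann_series:
  assumes full: "ann_series m = UNIV"
  shows "is_product n x \<Longrightarrow> 2 ^ k \<le> n \<Longrightarrow> x \<in> ann_series (m - k)"
proof (induction arbitrary: k rule: is_product.induct)
  case (single a)
  have "k < (2::nat) ^ k" by (rule less_exp)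
  then have "k = 0" using single.prems by linarith
  then show ?case using full by simp
next
  case (mult p x q y)
  show ?case
  proof (cases k)
    case 0
    then show ?thesis using full by simp
  next
    case (Suc l)
    with mult.prems have "2 ^ l \<le> p \<or> 2 ^ l \<le> q" by auto
    then have factor: "x \<in> ann_series (m - l) \<or> y \<in> ann_series (m - l)"
      using mult.IH by blast
    show ?thesis
    proof (cases "m - l")
      case 0
      then have "m - k = 0" using Suc by simp
      then show ?thesis using factor 0 by auto
    next
      case (Suc d)
      then have "m - k = d" using \<open>k = Suc l\<close> by simp
      then show ?thesis using factor Suc by auto
    qed
  qed
qed

lemma nilpotent_if_ann_series_UNIV:
  assumes "ann_series m = UNIV"
  shows nilpotent
  unfolding nilpotent_def
  using is_product_in_ann_series[OF assms, where k = m] by auto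

end

sublocale left_symmetric_algebra \<subseteq> lie: lie_algebra scale "commutator mul"
  by (rule lie_algebra_commutator)

context left_symmetric_algebra
begin

text \<open>For a product \<open>x \<star> b\<close>, left symmetry reads
  \<open>a \<star> (x \<star> b) = (a \<star> x) \<star> b - (x \<star> a) \<star> b + x \<star> (a \<star> b)\<close>; each term on the right is again an
  element of the preceding right power times an element of the algebra.\<close>

lemma right_power_left_ideal: "x \<in> right_power i \<Longrightarrow> a \<star> x \<in> right_power i"
proof (induction i arbitrary: x rule: right_power.induct)
  case (3 i)
  let ?P = "right_power (Suc i)" and ?Q = "right_power (Suc (Suc i))"
  have sub: "subspace ?Q" by (rule subspace_right_power)
  have generator: "a \<star> (y \<star> b) \<in> ?Q" if y: "y \<in> ?P" for y b
  proof -
    have "commutator mul a y \<in> ?P"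
      unfolding commutator_def
      using "3.IH"[OF y] right_power_right_ideal[OF y]
      by (rule subspace_diff[OF subspace_right_power])
    then have "commutator mul a y \<star> b + y \<star> (a \<star> b) \<in> ?Q"
      using y by (intro subspace_add[OF sub] mul_in_right_power_Suc)
    then show ?thesis by (simp add: left_symmetric)
  qed
  have "?Q \<subseteq> {z. a \<star> z \<in> ?Q}"
    unfolding right_power.simps(3) span_prod_def
  proof (rule span_minimal)
    show "{x \<star> y |x y. x \<in> ?P \<and> y \<in> UNIV} \<subseteq>
        {z. a \<star> z \<in> span {x \<star> y |x y. x \<in> ?P \<and> y \<in> UNIV}}"
      using generator by (auto simp: span_prod_def)
    show "subspace {z. a \<star> z \<in> span {x \<star> y |x y. x \<in> ?P \<and> y \<in> UNIV}}"
      by (auto simp: subspace_def span_zero span_add span_scale)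
  qed
  then show ?case using "3.prems" by blast
qed simp_all

text \<open>Here \<open>c - j\<close> is the number of steps left until the lower central series vanishes. For \<open>x\<close>
  in \<open>R\<^sup>i \<inter> C\<^sup>j\<close>, the product \<open>x \<star> a\<close> lies in \<open>R\<^sup>i\<^sup>+\<^sup>1\<close>, and \<open>a \<star> x = [a, x] + x \<star> a\<close>
  differs from it by an element of \<open>R\<^sup>i \<inter> C\<^sup>j\<^sup>+\<^sup>1\<close>.\<close>

lemma lower_central_inter_right_power_subset_ann_series:
  assumes vanish: "lie.lower_central_series c = {0}"
    and next_power: "right_power (Suc (Suc i)) \<subseteq> ann_series n"
    and "j \<le> c"
  shows "right_power (Suc i) \<inter> lie.lower_central_series j \<subseteq> ann_series (n + (c - j))"
  using \<open>j \<le> c\<close>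
proof (induction j rule: inc_induct)
  case base
  show ?case
    using vanish subspace_0[OF subspace_ann_series] by auto
next
  case (step j)
  let ?P = "right_power (Suc i)" and ?T = "ann_series (n + (c - Suc j))"
  show ?case
  proof
    fix x assume x: "x \<in> ?P \<inter> lie.lower_central_series j"
    have right: "x \<star> a \<in> ?T" for a
    proof -
      have "x \<star> a \<in> ann_series n"
        using x next_power mul_in_right_power_Suc by blast
      then show ?thesis using ann_series_mono[of n "n + (c - Suc j)"] by auto
    qed
    have left: "a \<star> x \<in> ?T" for a
    proof -
      have "commutator mul a x \<in> ?P"
        unfolding commutator_def using x
        by (intro subspace_diff[OF subspace_right_power] right_power_left_ideal
            right_power_right_ideal) auto
      moreover have "commutator mul a x \<in> lie.lower_central_series (Suc j)"
        using x by (simp add: lie.mul_in_span_prod)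
      ultimately have "commutator mul a x \<in> ?T"
        using step.IH by blast
      then have "commutator mul a x + x \<star> a \<in> ?T"
        using right by (intro subspace_add[OF subspace_ann_series])
      then show ?thesis by (simp add: commutator_def)
    qed
    have "n + (c - j) = Suc (n + (c - Suc j))"
      using step.hyps by simp
    then show "x \<in> ann_series (n + (c - j))"
      using left right by simp
  qed
qed

text \<open>With \<open>j = 0\<close> above, each of the right powers costs at most \<open>c\<close> further terms of
  the annihilator series.\<close>

lemma ann_series_eventually_UNIV:
  assumes right_nilpotent and "lie.lie_nilpotent"
  shows "\<exists>m. ann_series m = UNIV"
proof -
  obtain k where k: "right_power (Suc k) = {0}"
    using assms(1) by (auto simp: right_nilpotent_def)
  obtain c where c: "lie.lower_central_series c = {0}"
    using assms(2) by (auto simp: lie.lie_nilpotent_def)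
  have "\<exists>n. right_power (Suc i) \<subseteq> ann_series n" if "i \<le> k" for i
    using that
  proof (induction i rule: inc_induct)
    case base
    show ?case using k by (intro exI[of _ 0]) simp
  next
    case (step i)
    then obtain n where "right_power (Suc (Suc i)) \<subseteq> ann_series n" by blast
    from lower_central_inter_right_power_subset_ann_series[OF c this, of 0]
    show ?case by auto
  qed
  from this[of 0] show ?thesis by auto
qed

end

theorem theorem5p10:
  fixes scale :: "'f::field_char_0 \<Rightarrow> 'v::ab_group_add \<Rightarrow> 'v"
    and mul :: "'v \<Rightarrow> 'v \<Rightarrow> 'v"
  assumes "left_symmetric_algebra scale mul"
    and "\<exists>B. finite_dimensional_vector_space scale B"
    and "nonassoc_algebra.right_nilpotent scale mul"
    and "lie_algebra.lie_nilpotent scale (commutator mul)"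
  shows "vector_space.dim scale (nonassoc_algebra.ann_series mul 1) \<ge> 1 \<and>
    (\<exists>m\<ge>1. nonassoc_algebra.ann_series mul m = UNIV) \<and>
    nonassoc_algebra.nilpotent mul \<and>
    (nonassoc_algebra.span_prod scale mul UNIV UNIV \<noteq> {0} \<longrightarrow>
      nonassoc_algebra.ann_series mul 1 \<inter> nonassoc_algebra.span_prod scale mul UNIV UNIV \<noteq> {0})"
proof -
  interpret left_symmetric_algebra scale mul by (rule assms(1))
  obtain m where m: "ann_series m = UNIV"
    using ann_series_eventually_UNIV assms(3,4) by blast
  have "\<exists>w::'v. w \<noteq> 0"
    using assms(3) subspace_0[OF subspace_right_power] unfolding right_nilpotent_def by blast
  then obtain z where z: "z \<in> ann_series 1" "z \<noteq> 0"
    using ideal_meets_annihilator[OF m, of UNIV] by blast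
  \<comment> \<open>By convention \<open>dim\<close> is \<open>0\<close> on infinite-dimensional subspaces, so a nonzero element
    gives positive dimension only in the presence of a finite basis.\<close>
  have "dim (ann_series 1) \<noteq> 0"
  proof -
    obtain B where "finite_dimensional_vector_space scale B" using assms(2) by blast
    then interpret fin: finite_dimensional_vector_space scale B .
    show ?thesis using z fin.dim_eq_0 by blast
  qed
  moreover have "\<exists>m\<ge>1. ann_series m = UNIV"
    using m ann_series_Suc_mono[of m] by (intro exI[of _ "Suc m"]) auto
  moreover have nilpotent
    using m by (rule nilpotent_if_ann_series_UNIV)
  moreover have "ann_series 1 \<inter> span_prod UNIV UNIV \<noteq> {0}" if products: "span_prod UNIV UNIV \<noteq> {0}"
  proof -
    obtain w where w: "w \<in> span_prod UNIV UNIV" "w \<noteq> 0"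
      using products subspace_0[OF subspace_span_prod] by blast
    have "\<exists>z \<in> ann_series 1 \<inter> span_prod UNIV UNIV. z \<noteq> 0"
      by (rule ideal_meets_annihilator[OF m _ _ w]) (simp_all add: mul_in_span_prod)
    then show ?thesis by blast
  qed
  ultimately show ?thesis by simp
qed

end
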